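(* A displacement field $\mathbf{u}:\Omega\to\mathbb{R}^3$ is universal for the orthotropic class $\mathbb{Z}_4^-$ of linear strain-gradient elastic solids if and only if it is the superposition (sum) of a homogeneous displacement field and a field of the form $$\bigl(c_1x_2x_3+c_2x_1x_3,\; -c_2x_2x_3+c_3x_1x_3,\; g(x_1,x_2)\bigr),\qquad g(x_1,x_2)=d_1+d_2x_1+d_3x_2+d_4x_1x_2+d_5(x_2^2-x_1^2),$$ for some real constants $c_1,c_2,c_3,d_1,\dots,d_5$.
   Context: $\Omega\subset\mathbb{R}^3$ is a nonempty convex open set with Cartesian coordinates $(x_1,x_2,x_3)$ and orthonormal basis $e_1,e_2,e_3$. Repeated indices are summed over $1,2,3$ and a comma denotes partial differentiation. A displacement field is a smooth map $\mathbf{u}:\Omega\to\mathbb{R}^3$, with strain $e_{lm}=\tfrac12(u_{l,m}+u_{m,l})$. It is homogeneous if $\mathbf{u}(\mathbf{x})=\mathbf{H}\mathbf{x}+\mathbf{b}$ for a constant matrix $\mathbf{H}$ and constant vector $\mathbf{b}$. A strain-gradient material is a triple $(\mathsf{C},\mathsf{M},\mathsf{A})$ of constant real tensors of orders $4,5,6$ with index symmetries $\mathsf{C}_{ijlm}=\mathsf{C}_{jilm}=\mathsf{C}_{lmij}$, $\mathsf{M}_{ijklm}=\mathsf{M}_{jiklm}=\mathsf{M}_{ijlkm}$, $\mathsf{A}_{ijklmn}=\mathsf{A}_{jiklmn}=\mathsf{A}_{lmnijk}$. Its stress and hyper-stress are $\sigma_{ij}=\mathsf{C}_{ijlm}e_{lm}+\mathsf{M}_{ijlmn}e_{lm,n}$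 and $\tau_{ijk}=\mathsf{M}_{lmijk}e_{lm}+\mathsf{A}_{ijklmn}e_{lm,n}$, and the equilibrium equations without body forces are $\sigma_{ij,j}-\tau_{ijk,jk}=0$ in $\Omega$ for $i=1,2,3$. For a subgroup $G\subset \mathrm{O}(3)$, a tensor $T$ of order $p$ is $G$-invariant if $Q_{i_1j_1}\cdots Q_{i_pj_p}T_{j_1\dots j_p}=T_{i_1\dots i_p}$ for all $Q\in G$. $\mathbb{Z}_4$ is generated by the rotation $R$ by $\pi/2$ about $e_3$; $\mathbb{Z}_4^-$ is generated by $-R$; $\mathbb{D}_4$ is generated by $R$ and the rotation by $\pi$ about $e_1$; $\mathbb{Z}_2^c=\{I,-I\}$, and $G\oplus\mathbb{Z}_2^c$ is the group generated by $G$ and $-I$. The class $\mathbb{Z}_4^-$ is the set of all materials with $\mathsf{C}$ $\mathbb{D}_4\oplus\mathbb{Z}_2^c$-invariant (6 independent constants), $\mathsf{M}$ $\mathbb{Z}_4^-$-invariant (26 independent constants), and $\mathsf{A}$ $\mathbb{Z}_4\oplus\mathbb{Z}_2^c$-invariant (45 independent constants). A displacement field is universal for the class if it satisfies the equilibrium equations for every material in the class. *)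

theory Defs
  imports "HOL-Analysis.Analysis" "HOL-Algebra.Generated_Groups"
begin

section \<open>Differentiation\<close>

text \<open>
  A displacement field on an open set \<open>\<Omega>\<close> is represented by a total function. Only its values on
  \<open>\<Omega>\<close> matter: by openness they determine all derivatives at the points of \<open>\<Omega>\<close>.
\<close>

fun k_times_differentiable_on ::
    "nat \<Rightarrow> ('a::real_normed_vector \<Rightarrow> 'b::real_normed_vector) \<Rightarrow> 'a set \<Rightarrow> bool" where
  "k_times_differentiable_on 0 f S \<longleftrightarrow> continuous_on S f"
| "k_times_differentiable_on (Suc k) f S \<longleftrightarrow>
     (\<forall>x\<in>S. f differentiable (at x)) \<and>
     (\<forall>v. k_times_differentiable_on k (\<lambda>x. frechet_derivative f (at x) v) S)"

definition smooth_on :: "'a::real_normed_vector set \<Rightarrow> ('a \<Rightarrow> 'b::real_normed_vector) \<Rightarrow> bool" where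
  "smooth_on S f \<longleftrightarrow> (\<forall>k. k_times_differentiable_on k f S)"

text \<open>The partial derivative with respect to the \<open>j\<close>-th coordinate.\<close>

definition pd :: "3 \<Rightarrow> (real^3 \<Rightarrow> real) \<Rightarrow> real^3 \<Rightarrow> real" where
  "pd j f x = frechet_derivative f (at x) (axis j 1)"

definition strain :: "(real^3 \<Rightarrow> real^3) \<Rightarrow> 3 \<Rightarrow> 3 \<Rightarrow> real^3 \<Rightarrow> real" where
  "strain u l m x = (pd m (\<lambda>y. u y $ l) x + pd l (\<lambda>y. u y $ m) x) / 2"

definition homogeneous_on :: "(real^3) set \<Rightarrow> (real^3 \<Rightarrow> real^3) \<Rightarrow> bool" where
  "homogeneous_on \<Omega> u \<longleftrightarrow> (\<exists>(H :: real^3^3) b. \<forall>x\<in>\<Omega>. u x = H *v x + b)"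


section \<open>Strain-gradient materials\<close>

text \<open>Tensors are given by their components in the orthonormal basis.\<close>

type_synonym tensor4 = "3 \<Rightarrow> 3 \<Rightarrow> 3 \<Rightarrow> 3 \<Rightarrow> real"
type_synonym tensor5 = "3 \<Rightarrow> 3 \<Rightarrow> 3 \<Rightarrow> 3 \<Rightarrow> 3 \<Rightarrow> real"
type_synonym tensor6 = "3 \<Rightarrow> 3 \<Rightarrow> 3 \<Rightarrow> 3 \<Rightarrow> 3 \<Rightarrow> 3 \<Rightarrow> real"
type_synonym material = "tensor4 \<times> tensor5 \<times> tensor6"

definition strain_gradient_materials :: "material set" where
  "strain_gradient_materials = {(C, M, A).
     (\<forall>i j l m. C i j l m = C j i l m \<and> C i j l m = C l m i j) \<and>
     (\<forall>i j k l m. M i j k l m = M j i k l m \<and> M i j k l m = M i j l k m) \<and>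
     (\<forall>i j k l m n. A i j k l m n = A j i k l m n \<and> A i j k l m n = A l m n i j k)}"

definition stress :: "material \<Rightarrow> (real^3 \<Rightarrow> real^3) \<Rightarrow> 3 \<Rightarrow> 3 \<Rightarrow> real^3 \<Rightarrow> real" where
  "stress = (\<lambda>(C, M, A) u i j x.
     (\<Sum>l\<in>UNIV. \<Sum>m\<in>UNIV. C i j l m * strain u l m x) +
     (\<Sum>l\<in>UNIV. \<Sum>m\<in>UNIV. \<Sum>n\<in>UNIV. M i j l m n * pd n (strain u l m) x))"

definition hyperstress :: "material \<Rightarrow> (real^3 \<Rightarrow> real^3) \<Rightarrow> 3 \<Rightarrow> 3 \<Rightarrow> 3 \<Rightarrow> real^3 \<Rightarrow> real" where
  "hyperstress = (\<lambda>(C, M, A) u i j k x.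
     (\<Sum>l\<in>UNIV. \<Sum>m\<in>UNIV. M l m i j k * strain u l m x) +
     (\<Sum>l\<in>UNIV. \<Sum>m\<in>UNIV. \<Sum>n\<in>UNIV. A i j k l m n * pd n (strain u l m) x))"

definition equilibrium :: "material \<Rightarrow> (real^3) set \<Rightarrow> (real^3 \<Rightarrow> real^3) \<Rightarrow> bool" where
  "equilibrium \<mu> \<Omega> u \<longleftrightarrow> (\<forall>x\<in>\<Omega>. \<forall>i.
     (\<Sum>j\<in>UNIV. pd j (stress \<mu> u i j) x) -
     (\<Sum>j\<in>UNIV. \<Sum>k\<in>UNIV. pd k (pd j (hyperstress \<mu> u i j k)) x) = 0)"

definition universal :: "material set \<Rightarrow> (real^3) set \<Rightarrow> (real^3 \<Rightarrow> real^3) \<Rightarrow> bool" where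
  "universal \<K> \<Omega> u \<longleftrightarrow> (\<forall>\<mu>\<in>\<K>. equilibrium \<mu> \<Omega> u)"


section \<open>Symmetry groups\<close>

definition O3 :: "(real^3^3) monoid" where
  "O3 = \<lparr>carrier = {Q. orthogonal_matrix Q}, mult = (**), one = mat 1\<rparr>"

lemma group_O3: "group O3"
proof (rule groupI)
  fix Q assume "Q \<in> carrier O3"
  then show "\<exists>P\<in>carrier O3. P \<otimes>\<^bsub>O3\<^esub> Q = \<one>\<^bsub>O3\<^esub>"
    by (intro bexI[of _ "transpose Q"])
      (auto simp: O3_def orthogonal_matrix_def)
qed (auto simp: O3_def orthogonal_matrix_mul orthogonal_matrix_id matrix_mul_assoc)

text \<open>
  \<open>R4\<close> is the rotation by \<open>\<pi>/2\<close> about \<open>e\<^sub>3\<close>, oriented so that \<open>e\<^sub>1\<close> goes to \<open>e\<^sub>2\<close>; \<open>R2\<close> is the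
  rotation by \<open>\<pi>\<close> about \<open>e\<^sub>1\<close>. The matrices are listed by rows.
\<close>

definition R4 :: "real^3^3" where
  "R4 = vector [vector [0, -1, 0], vector [1, 0, 0], vector [0, 0, 1]]"

definition R2 :: "real^3^3" where
  "R2 = vector [vector [1, 0, 0], vector [0, -1, 0], vector [0, 0, -1]]"

definition Z4 :: "(real^3^3) set" where
  "Z4 = generate O3 {R4}"

definition Z4_minus :: "(real^3^3) set" where
  "Z4_minus = generate O3 {- R4}"

definition D4 :: "(real^3^3) set" where
  "D4 = generate O3 {R4, R2}"

text \<open>\<open>plus_Z2c G\<close> is \<open>G \<oplus> Z\<^sub>2\<^sup>c\<close>.\<close>

definition plus_Z2c :: "(real^3^3) set \<Rightarrow> (real^3^3) set" where
  "plus_Z2c G = generate O3 (G \<union> {- mat 1})"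

lemma R4_O3: "R4 \<in> carrier O3" and R2_O3: "R2 \<in> carrier O3"
  by (auto simp: O3_def R4_def R2_def orthogonal_matrix_def matrix_matrix_mult_def
      transpose_def mat_def vec_eq_iff forall_3 sum_3 vector_3)

lemma uminus_O3: "Q \<in> carrier O3 \<Longrightarrow> - Q \<in> carrier O3"
  by (auto simp: O3_def orthogonal_matrix_def matrix_matrix_mult_def transpose_def vec_eq_iff)

lemma subgroup_Z4: "subgroup Z4 O3"
  and subgroup_Z4_minus: "subgroup Z4_minus O3"
  and subgroup_D4: "subgroup D4 O3"
  unfolding Z4_def Z4_minus_def D4_def
  by (auto intro!: group.generate_is_subgroup[OF group_O3] R4_O3 R2_O3 uminus_O3)

definition invariant4 :: "(real^3^3) set \<Rightarrow> tensor4 \<Rightarrow> bool" where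
  "invariant4 G T \<longleftrightarrow> (\<forall>Q\<in>G. \<forall>i1 i2 i3 i4.
     (\<Sum>j1\<in>UNIV. \<Sum>j2\<in>UNIV. \<Sum>j3\<in>UNIV. \<Sum>j4\<in>UNIV.
        Q$i1$j1 * Q$i2$j2 * Q$i3$j3 * Q$i4$j4 * T j1 j2 j3 j4) = T i1 i2 i3 i4)"

definition invariant5 :: "(real^3^3) set \<Rightarrow> tensor5 \<Rightarrow> bool" where
  "invariant5 G T \<longleftrightarrow> (\<forall>Q\<in>G. \<forall>i1 i2 i3 i4 i5.
     (\<Sum>j1\<in>UNIV. \<Sum>j2\<in>UNIV. \<Sum>j3\<in>UNIV. \<Sum>j4\<in>UNIV. \<Sum>j5\<in>UNIV.
        Q$i1$j1 * Q$i2$j2 * Q$i3$j3 * Q$i4$j4 * Q$i5$j5 * T j1 j2 j3 j4 j5) = T i1 i2 i3 i4 i5)"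

definition invariant6 :: "(real^3^3) set \<Rightarrow> tensor6 \<Rightarrow> bool" where
  "invariant6 G T \<longleftrightarrow> (\<forall>Q\<in>G. \<forall>i1 i2 i3 i4 i5 i6.
     (\<Sum>j1\<in>UNIV. \<Sum>j2\<in>UNIV. \<Sum>j3\<in>UNIV. \<Sum>j4\<in>UNIV. \<Sum>j5\<in>UNIV. \<Sum>j6\<in>UNIV.
        Q$i1$j1 * Q$i2$j2 * Q$i3$j3 * Q$i4$j4 * Q$i5$j5 * Q$i6$j6 * T j1 j2 j3 j4 j5 j6)
     = T i1 i2 i3 i4 i5 i6)"

definition class_Z4_minus :: "material set" where
  "class_Z4_minus = {(C, M, A). (C, M, A) \<in> strain_gradient_materials \<and>
     invariant4 (plus_Z2c D4) C \<and> invariant5 Z4_minus M \<and> invariant6 (plus_Z2c Z4) A}"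

end

(*
Materials with M = A = 0 already force u1 and u2 to have the stated quadratic form and
u3 = a x3 + h(x1, x2) with h harmonic. One material with M nonzero then gives h_111 = h_222 = 0, so
together with harmonicity all third derivatives of u vanish and u is quadratic. Conversely, on a
quadratic field the M- and A-terms of the equilibrium equations vanish, since they involve only
third and fourth derivatives of u, and the C-term vanishes by the tetragonal symmetry of C.
*)
theory Submission
  imports Defs
begin

text \<open>The equilibrium equations are linear in the material, so switching on one constant at a
  time isolates one combination of derivatives of u. The constant \<open>c13\<close> gives u1,13 +
  u2,23 = 0, hence the opposite signs of \<open>c2\<close>; subtracting this from the
  \<open>c44\<close> equation gives u3,11 + u3,22 = 0. Elasticity alone cannot go further: (0, 0,
  h(x1,x2)) with h harmonic is in equilibrium for every admissible C. A component of M with a single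
  index 3 is needed, because M(1,1,3,1,1) acts on e13,11 and so produces h_111. Under -R the index 3
  contributes a factor -1 while the indices 1 and 2 are exchanged, so the component M(2,2,3,2,2)
  must be the negative of it. Under R itself the two would have to be equal and opposite at once
  with other signs, so the choice is tied to the improper generator. The groups are given by
  generators, whereas invariance speaks of all their elements. Every element is therefore shown to
  be a signed permutation matrix fixing the third axis up to sign; invariance of the test tensors
  then reduces to counting signs.\<close>

section \<open>Smooth functions and partial derivatives\<close>

text \<open>On an open set a derivative at a point sees only values in the set, so the replacement
  passes through every order. The closure lemmas below need this because their derivative rules hold
  only at points of \<open>S\<close>.\<close>

lemma k_times_differentiable_on_cong:
  assumes "open S" "\<And>x. x \<in> S \<Longrightarrow> f x = g x" "k_times_differentiable_on k f S"
  shows "k_times_differentiable_on k g S"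
  using assms(2,3)
proof (induction k arbitrary: f g)
  case 0
  then show ?case using continuous_on_cong[of S S f g] by auto
next
  case (Suc k)
  have diff: "f differentiable at x" if "x \<in> S" for x
    using Suc.prems that by auto
  have frechet: "frechet_derivative f (at x) = frechet_derivative g (at x)" if "x \<in> S" for x
    by (rule frechet_derivative_transform_within_open[OF diff[OF that] assms(1) that Suc.prems(1)])
  have "g differentiable at x" if "x \<in> S" for x
    using has_derivative_transform_within_open[OF diff[OF that, unfolded frechet_derivative_works]
        assms(1) that Suc.prems(1)]
    by (rule differentiableI)
  moreover have "k_times_differentiable_on k (\<lambda>x. frechet_derivative g (at x) v) S" for v
    by (rule Suc.IH[of "\<lambda>x. frechet_derivative f (at x) v"]) (use frechet Suc.prems in auto)
  ultimately show ?case by auto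
qed

lemma k_times_differentiable_on_bounded_linear:
  assumes "open S" "bounded_linear h" "k_times_differentiable_on k f S"
  shows "k_times_differentiable_on k (\<lambda>x. h (f x)) S"
  using assms(3)
proof (induction k arbitrary: f)
  case 0
  then show ?case using bounded_linear.continuous_on[OF assms(2)] by auto
next
  case (Suc k)
  have der: "((\<lambda>x. h (f x)) has_derivative (\<lambda>v. h (frechet_derivative f (at x) v))) (at x)"
    if "x \<in> S" for x
    by (rule bounded_linear.has_derivative[OF assms(2)])
      (use Suc.prems that in \<open>auto simp flip: frechet_derivative_works\<close>)
  have "k_times_differentiable_on k (\<lambda>x. frechet_derivative (\<lambda>x. h (f x)) (at x) v) S" for v
    by (rule k_times_differentiable_on_cong[OF assms(1) _ Suc.IH])
      (use Suc.prems frechet_derivative_at[OF der] in \<open>auto dest: fun_cong[of _ _ v]\<close>)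
  then show ?case using der by (auto simp: differentiable_def)
qed

lemma k_times_differentiable_on_add:
  assumes "open S" "k_times_differentiable_on k f S" "k_times_differentiable_on k g S"
  shows "k_times_differentiable_on k (\<lambda>x. f x + g x) S"
  using assms(2,3)
proof (induction k arbitrary: f g)
  case 0
  then show ?case by (auto intro: continuous_on_add)
next
  case (Suc k)
  have der: "((\<lambda>x. f x + g x) has_derivative
      (\<lambda>v. frechet_derivative f (at x) v + frechet_derivative g (at x) v)) (at x)"
    if "x \<in> S" for x
    by (rule has_derivative_add) (use Suc.prems that in \<open>auto simp flip: frechet_derivative_works\<close>)
  have "k_times_differentiable_on k (\<lambda>x. frechet_derivative (\<lambda>x. f x + g x) (at x) v) S" for v
    by (rule k_times_differentiable_on_cong[OF assms(1) _ Suc.IH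
          [of "\<lambda>x. frechet_derivative f (at x) v" "\<lambda>x. frechet_derivative g (at x) v"]])
      (use Suc.prems frechet_derivative_at[OF der] in \<open>auto dest: fun_cong[of _ _ v]\<close>)
  then show ?case using der by (auto simp: differentiable_def)
qed

lemma k_times_differentiable_on_const: "k_times_differentiable_on k (\<lambda>x. c) S"
  by (induction k arbitrary: c) auto

lemma smooth_on_const: "smooth_on S (\<lambda>x. c)"
  by (simp add: smooth_on_def k_times_differentiable_on_const)

lemma smooth_on_add:
  "open S \<Longrightarrow> smooth_on S f \<Longrightarrow> smooth_on S g \<Longrightarrow> smooth_on S (\<lambda>x. f x + g x)"
  by (simp add: smooth_on_def k_times_differentiable_on_add)

lemma smooth_on_bounded_linear:
  "open S \<Longrightarrow> bounded_linear h \<Longrightarrow> smooth_on S f \<Longrightarrow> smooth_on S (\<lambda>x. h (f x))"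
  by (simp add: smooth_on_def k_times_differentiable_on_bounded_linear)

lemma smooth_on_mult_left:
  fixes f :: "'a::real_normed_vector \<Rightarrow> real"
  shows "open S \<Longrightarrow> smooth_on S f \<Longrightarrow> smooth_on S (\<lambda>x. c * f x)"
  by (rule smooth_on_bounded_linear[OF _ bounded_linear_mult_right])

lemma smooth_on_divide:
  fixes f :: "'a::real_normed_vector \<Rightarrow> real"
  shows "open S \<Longrightarrow> smooth_on S f \<Longrightarrow> smooth_on S (\<lambda>x. f x / c)"
  by (rule smooth_on_bounded_linear[OF _ bounded_linear_divide])

lemma smooth_on_component: "open S \<Longrightarrow> smooth_on S f \<Longrightarrow> smooth_on S (\<lambda>x. f x $ i)"
  by (rule smooth_on_bounded_linear[OF _ bounded_linear_vec_nth])

lemma smooth_on_sum: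
  assumes "open S" "\<And>a. a \<in> I \<Longrightarrow> smooth_on S (f a)"
  shows "smooth_on S (\<lambda>x. \<Sum>a\<in>I. f a x)"
  using assms(2)
  by (induction I rule: infinite_finite_induct) (auto intro: smooth_on_const smooth_on_add assms(1))

lemma smooth_on_imp_differentiable:
  assumes "smooth_on S f" "x \<in> S"
  shows "f differentiable at x"
proof -
  have "k_times_differentiable_on (Suc 0) f S" using assms(1) unfolding smooth_on_def by blast
  then show ?thesis using assms(2) by simp
qed

lemma smooth_on_imp_continuous_on: "smooth_on S f \<Longrightarrow> continuous_on S f"
  using k_times_differentiable_on.simps(1) unfolding smooth_on_def by blast

lemma smooth_on_pd:
  assumes "smooth_on S f"
  shows "smooth_on S (pd j f)"
  unfolding smooth_on_def
proof
  fix k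
  have "k_times_differentiable_on (Suc k) f S" using assms unfolding smooth_on_def by blast
  then show "k_times_differentiable_on k (pd j f) S" by (simp add: pd_def[abs_def])
qed

section \<open>Calculus of partial derivatives\<close>

lemma pdI: "(f has_derivative D) (at x) \<Longrightarrow> pd j f x = D (axis j 1)"
  unfolding pd_def by (simp flip: frechet_derivative_at)

lemma pd_has_derivative: "f differentiable at x \<Longrightarrow> (f has_derivative (\<lambda>v. \<Sum>j\<in>UNIV. v $ j * pd j f x)) (at x)"
proof -
  assume "f differentiable at x"
  then have D: "(f has_derivative frechet_derivative f (at x)) (at x)"
    using frechet_derivative_works by blast
  have "frechet_derivative f (at x) v = (\<Sum>j\<in>UNIV. v $ j * pd j f x)" for v
  proof -
    have "frechet_derivative f (at x) v = frechet_derivative f (at x) (\<Sum>j\<in>UNIV. v $ j *\<^sub>R axis j 1)"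
      using basis_expansion[of v] by (simp add: scalar_mult_eq_scaleR)
    also have "\<dots> = (\<Sum>j\<in>UNIV. v $ j * pd j f x)"
      using has_derivative_linear[OF D] by (simp add: linear_sum linear_cmul pd_def)
    finally show ?thesis .
  qed
  then have "frechet_derivative f (at x) = (\<lambda>v. \<Sum>j\<in>UNIV. v $ j * pd j f x)" ..
  with D show ?thesis by simp
qed

text \<open>No differentiability is assumed: if \<open>f\<close> has no derivative at
  \<open>x\<close>, both Frechet derivatives are the same arbitrary choice, since the predicates
  they choose from coincide.\<close>

lemma pd_cong:
  assumes "open S" "x \<in> S" "\<And>y. y \<in> S \<Longrightarrow> f y = g y"
  shows "pd j f x = pd j g x"
proof (cases "f differentiable at x")
  case True
  then show ?thesis
    unfolding pd_def using frechet_derivative_transform_within_open[OF True assms] by simp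
next
  case False
  have "(f has_derivative D) (at x) \<longleftrightarrow> (g has_derivative D) (at x)" for D
  proof
    assume "(f has_derivative D) (at x)"
    then show "(g has_derivative D) (at x)"
      by (rule has_derivative_transform_within_open[OF _ assms])
  next
    assume "(g has_derivative D) (at x)"
    then show "(f has_derivative D) (at x)"
      by (rule has_derivative_transform_within_open[OF _ assms(1,2)]) (simp add: assms(3))
  qed
  then show ?thesis unfolding pd_def frechet_derivative_def by simp
qed

lemma pd_const [simp]: "pd j (\<lambda>x. c) x = 0"
  by (simp add: pd_def)

lemma pd_add:
  assumes "f differentiable at x" "g differentiable at x"
  shows "pd j (\<lambda>x. f x + g x) x = pd j f x + pd j g x"
proof -
  have "((\<lambda>x. f x + g x) has_derivative
      (\<lambda>v. frechet_derivative f (at x) v + frechet_derivative g (at x) v)) (at x)"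
    by (rule has_derivative_add) (use assms in \<open>simp add: frechet_derivative_works\<close>)+
  from pdI[OF this] show ?thesis by (simp add: pd_def)
qed

lemma pd_mult_left:
  assumes "f differentiable at x"
  shows "pd j (\<lambda>x. c * f x) x = c * pd j f x"
proof -
  have "((\<lambda>x. c * f x) has_derivative (\<lambda>v. c * frechet_derivative f (at x) v)) (at x)"
    by (rule has_derivative_mult_right) (use assms in \<open>simp add: frechet_derivative_works\<close>)
  from pdI[OF this] show ?thesis by (simp add: pd_def)
qed

lemma pd_divide_right:
  assumes "f differentiable at x"
  shows "pd j (\<lambda>x. f x / c) x = pd j f x / c"
  using pd_mult_left[OF assms, of j "inverse c"] by (simp add: field_class.field_divide_inverse mult.commute)

lemma pd_sum:
  assumes "\<And>a. a \<in> I \<Longrightarrow> f a differentiable at x"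
  shows "pd j (\<lambda>x. \<Sum>a\<in>I. f a x) x = (\<Sum>a\<in>I. pd j (f a) x)"
proof -
  have "((\<lambda>x. \<Sum>a\<in>I. f a x) has_derivative (\<lambda>v. \<Sum>a\<in>I. frechet_derivative (f a) (at x) v)) (at x)"
    by (rule has_derivative_sum) (use assms in \<open>simp add: frechet_derivative_works\<close>)
  from pdI[OF this] show ?thesis by (simp add: pd_def)
qed

subsection \<open>Symmetry of second derivatives\<close>

lemma pd_DERIV_line:
  assumes "f differentiable at (a + s *\<^sub>R axis j 1)"
  shows "((\<lambda>s. f (a + s *\<^sub>R axis j 1)) has_real_derivative pd j f (a + s *\<^sub>R axis j 1)) (at s)"
proof -
  let ?y = "a + s *\<^sub>R axis j 1"
  have D: "(f has_derivative frechet_derivative f (at ?y)) (at ?y)"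
    using assms frechet_derivative_works by blast
  have "((\<lambda>s. a + s *\<^sub>R axis j 1) has_derivative (\<lambda>h. h *\<^sub>R axis j 1)) (at s)"
    by (auto intro!: derivative_eq_intros)
  from has_derivative_compose[OF this D] show ?thesis
    by (rule has_derivative_imp_has_field_derivative)
      (simp add: pd_def linear_cmul[OF has_derivative_linear[OF D]])
qed

text \<open>The mean value theorem is applied in direction \<open>j\<close> to the difference of
  \<open>f\<close> between the two sides \<open>r = t\<close> and \<open>r = 0\<close> of the
  square, then in direction \<open>k\<close> to \<open>pd j f\<close>. The left-hand side is
  symmetric in \<open>j\<close> and \<open>k\<close>, which is what \<open>pd_commute\<close>
  exploits.\<close>

lemma mixed_difference:
  fixes x :: "real^3" and j k
  defines "y \<equiv> \<lambda>s r. x + s *\<^sub>R axis j 1 + r *\<^sub>R axis k 1"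
  assumes "open S" "smooth_on S f" "0 < t"
    and S: "\<And>s r. 0 \<le> s \<Longrightarrow> s \<le> t \<Longrightarrow> 0 \<le> r \<Longrightarrow> r \<le> t \<Longrightarrow> y s r \<in> S"
  obtains s r where "0 \<le> s" "s \<le> t" "0 \<le> r" "r \<le> t"
    "f (y t t) - f (y t 0) - f (y 0 t) + f (y 0 0) = t * (t * pd k (pd j f) (y s r))"
proof -
  have Dj: "((\<lambda>s. f (y s r)) has_real_derivative pd j f (y s r)) (at s)"
    if "0 \<le> s" "s \<le> t" "0 \<le> r" "r \<le> t" for s r
    using pd_DERIV_line[of f "x + r *\<^sub>R axis k 1" s j] smooth_on_imp_differentiable[OF assms(3) S[OF that]]
    by (simp add: y_def add_ac)
  have Dk: "((\<lambda>r. pd j f (y s r)) has_real_derivative pd k (pd j f) (y s r)) (at r)"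
    if "0 \<le> s" "s \<le> t" "0 \<le> r" "r \<le> t" for s r
    using pd_DERIV_line[of "pd j f" "x + s *\<^sub>R axis j 1" r k]
      smooth_on_imp_differentiable[OF smooth_on_pd[OF assms(3)] S[OF that]]
    by (simp add: y_def)
  have "((\<lambda>s. f (y s t) - f (y s 0)) has_real_derivative pd j f (y s t) - pd j f (y s 0)) (at s)"
    if "0 \<le> s" "s \<le> t" for s
    using Dj that \<open>0 < t\<close> by (intro DERIV_diff) auto
  from MVT2[OF \<open>0 < t\<close> this]
  obtain s where s: "0 < s" "s < t"
    "f (y t t) - f (y t 0) - (f (y 0 t) - f (y 0 0)) = t * (pd j f (y s t) - pd j f (y s 0))"
    by auto
  from MVT2[OF \<open>0 < t\<close> Dk[of s]] s
  obtain r where "0 < r" "r < t" "pd j f (y s t) - pd j f (y s 0) = t * pd k (pd j f) (y s r)"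
    by auto
  with s show ?thesis by (intro that[of s r]) auto
qed

text \<open>The same second difference over a small square equals t^2 times a value of either mixed
  derivative, so the two derivatives agree at some pair of points near \<open>x\<close>. With
  \<open>e\<close> half the supposed gap at \<open>x\<close>, continuity of both contradicts
  this.\<close>

lemma pd_commute:
  assumes "open S" "smooth_on S f" "x \<in> S"
  shows "pd k (pd j f) x = pd j (pd k f) x"
proof (rule ccontr)
  let ?F = "pd k (pd j f)" and ?G = "pd j (pd k f)"
  assume neq: "?F x \<noteq> ?G x"
  define e where "e = \<bar>?F x - ?G x\<bar> / 2"
  have "e > 0" using neq by (simp add: e_def)
  have "continuous (at x) ?F" "continuous (at x) ?G"
    using smooth_on_imp_continuous_on[OF smooth_on_pd[OF smooth_on_pd[OF assms(2)]]]
      continuous_on_eq_continuous_at[OF assms(1)] assms(3) by blast+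
  then obtain d1 d2 where d1: "d1 > 0" "\<And>z. dist z x < d1 \<Longrightarrow> dist (?F z) (?F x) < e"
    and d2: "d2 > 0" "\<And>z. dist z x < d2 \<Longrightarrow> dist (?G z) (?G x) < e"
    using \<open>e > 0\<close> unfolding continuous_at_eps_delta by metis
  obtain d3 where d3: "d3 > 0" "\<And>z. dist z x < d3 \<Longrightarrow> z \<in> S"
    using assms(1,3) unfolding open_dist by blast
  \<comment> \<open>A point of the square is at distance at most 2t from \<open>x\<close>; the
    divisor 3 makes this strictly less than all three radii.\<close>
  define t where "t = min d1 (min d2 d3) / 3"
  have "t > 0" using d1(1) d2(1) d3(1) by (simp add: t_def)
  have near: "dist (x + s *\<^sub>R axis i 1 + r *\<^sub>R axis l 1) x < min d1 (min d2 d3)"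
    if "0 \<le> s" "s \<le> t" "0 \<le> r" "r \<le> t" for s r i l
  proof -
    have "norm (s *\<^sub>R axis i 1 + r *\<^sub>R axis l 1 :: real^3) \<le> norm (s *\<^sub>R axis i 1 :: real^3) + norm (r *\<^sub>R axis l 1 :: real^3)"
      by (rule norm_triangle_ineq)
    also have "\<dots> = s + r" using that by (simp add: norm_axis_1)
    also have "\<dots> < 3 * t" using that \<open>t > 0\<close> by linarith
    finally show ?thesis by (simp add: dist_norm t_def add.assoc)
  qed
  obtain s r where sr: "0 \<le> s" "s \<le> t" "0 \<le> r" "r \<le> t"
    "f (x + t *\<^sub>R axis j 1 + t *\<^sub>R axis k 1) - f (x + t *\<^sub>R axis j 1 + 0 *\<^sub>R axis k 1)
      - f (x + 0 *\<^sub>R axis j 1 + t *\<^sub>R axis k 1) + f (x + 0 *\<^sub>R axis j 1 + 0 *\<^sub>R axis k 1)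
      = t * (t * ?F (x + s *\<^sub>R axis j 1 + r *\<^sub>R axis k 1))"
    using near d3(2) by (elim mixed_difference[OF assms(1,2) \<open>t > 0\<close>, rotated]) auto
  obtain s' r' where sr': "0 \<le> s'" "s' \<le> t" "0 \<le> r'" "r' \<le> t"
    "f (x + t *\<^sub>R axis k 1 + t *\<^sub>R axis j 1) - f (x + t *\<^sub>R axis k 1 + 0 *\<^sub>R axis j 1)
      - f (x + 0 *\<^sub>R axis k 1 + t *\<^sub>R axis j 1) + f (x + 0 *\<^sub>R axis k 1 + 0 *\<^sub>R axis j 1)
      = t * (t * ?G (x + s' *\<^sub>R axis k 1 + r' *\<^sub>R axis j 1))"
    using near d3(2) by (elim mixed_difference[OF assms(1,2) \<open>t > 0\<close>, rotated]) auto
  have "t * (t * ?F (x + s *\<^sub>R axis j 1 + r *\<^sub>R axis k 1))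
      = t * (t * ?G (x + s' *\<^sub>R axis k 1 + r' *\<^sub>R axis j 1))"
    using sr(5) sr'(5) by (simp only: scaleR_zero_left add_0_right add_ac)
  then have "?F (x + s *\<^sub>R axis j 1 + r *\<^sub>R axis k 1) = ?G (x + s' *\<^sub>R axis k 1 + r' *\<^sub>R axis j 1)"
    using \<open>t > 0\<close> by simp
  moreover have "\<bar>?F (x + s *\<^sub>R axis j 1 + r *\<^sub>R axis k 1) - ?F x\<bar> < e"
    using d1(2) near sr by (simp add: dist_real_def)
  moreover have "\<bar>?G (x + s' *\<^sub>R axis k 1 + r' *\<^sub>R axis j 1) - ?G x\<bar> < e"
    using d2(2) near sr' by (simp add: dist_real_def)
  ultimately show False unfolding e_def by argo
qed

subsection \<open>Quadratic functions\<close>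

lemma quadratic_has_derivative:
  fixes K :: "3 \<Rightarrow> 3 \<Rightarrow> real" and b :: "3 \<Rightarrow> real"
  assumes "\<And>j k. K j k = K k j"
  shows "((\<lambda>x. c + (\<Sum>j\<in>UNIV. b j * x $ j) + (\<Sum>j\<in>UNIV. \<Sum>k\<in>UNIV. K j k * x $ j * x $ k) / 2)
    has_derivative (\<lambda>v. \<Sum>j\<in>UNIV. v $ j * (b j + (\<Sum>k\<in>UNIV. K j k * x $ k)))) (at x)"
  unfolding sum_3
  by (auto intro!: derivative_eq_intros bounded_linear.has_derivative[OF bounded_linear_vec_nth]
      simp: field_simps assms[of 2 1] assms[of 3 1] assms[of 3 2])

lemma pd_pd_quadratic:
  fixes K :: "3 \<Rightarrow> 3 \<Rightarrow> real"
  assumes "open S" "x \<in> S" and sym: "\<And>j k. K j k = K k j"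
    and f: "\<And>x. x \<in> S \<Longrightarrow>
      f x = c + (\<Sum>j\<in>UNIV. b j * x $ j) + (\<Sum>j\<in>UNIV. \<Sum>k\<in>UNIV. K j k * x $ j * x $ k) / 2"
  shows "pd j (pd k f) x = K j k"
proof -
  have "pd k f y = b k + (\<Sum>l\<in>UNIV. K k l * y $ l)" if "y \<in> S" for y
    using pd_cong[OF assms(1) that f] pdI[OF quadratic_has_derivative[OF sym]]
    by (simp add: axis_def if_distrib[of "\<lambda>z. z * _"] cong: if_cong)
  from pd_cong[OF assms(1,2) this]
  have "pd j (pd k f) x = pd j (\<lambda>y. b k + (\<Sum>l\<in>UNIV. K k l * y $ l)) x" .
  also have "\<dots> = (\<Sum>l\<in>UNIV. K k l * axis j 1 $ l)"
    by (rule pdI) (auto intro!: derivative_eq_intros bounded_linear.has_derivative[OF bounded_linear_vec_nth])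
  also have "\<dots> = K j k"
    by (simp add: axis_def sym[of k j] if_distrib[of "\<lambda>z. _ * z"] cong: if_cong)
  finally show ?thesis .
qed

lemma zero_pd_imp_constant:
  assumes "open S" "convex S" "\<And>x. x \<in> S \<Longrightarrow> f differentiable at x"
    "\<And>x j. x \<in> S \<Longrightarrow> pd j f x = 0"
  shows "\<exists>c. \<forall>x\<in>S. f x = c"
proof (rule has_derivative_zero_constant[OF assms(2)])
  fix x assume "x \<in> S"
  then show "(f has_derivative (\<lambda>h. 0)) (at x within S)"
    using pd_has_derivative[OF assms(3), of x] assms(4) by (simp add: has_derivative_at_withinI)
qed

text \<open>Two integrations: the gradient minus its linear candidate, and then \<open>f\<close>
  minus its quadratic candidate, have vanishing partial derivatives and are constant by
  convexity.\<close>

lemma constant_pd_pd_imp_quadratic: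
  fixes K :: "3 \<Rightarrow> 3 \<Rightarrow> real"
  assumes "open S" "convex S" and smooth: "smooth_on S f"
    and sym: "\<And>j k. K j k = K k j"
    and K: "\<And>x j k. x \<in> S \<Longrightarrow> pd j (pd k f) x = K j k"
  obtains b c where "\<And>x. x \<in> S \<Longrightarrow>
    f x = c + (\<Sum>j\<in>UNIV. b j * x $ j) + (\<Sum>j\<in>UNIV. \<Sum>k\<in>UNIV. K j k * x $ j * x $ k) / 2"
proof -
  have "\<exists>d. \<forall>x\<in>S. pd k f x - (\<Sum>l\<in>UNIV. K k l * x $ l) = d" for k
  proof (rule zero_pd_imp_constant[OF assms(1,2)])
    fix x j assume x: "x \<in> S"
    have D: "((\<lambda>x. pd k f x - (\<Sum>l\<in>UNIV. K k l * x $ l)) has_derivative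
        (\<lambda>v. (\<Sum>j\<in>UNIV. v $ j * pd j (pd k f) x) - (\<Sum>l\<in>UNIV. K k l * v $ l))) (at x)"
      by (intro has_derivative_diff pd_has_derivative smooth_on_imp_differentiable[OF smooth_on_pd[OF smooth] x])
        (auto intro!: derivative_eq_intros bounded_linear.has_derivative[OF bounded_linear_vec_nth])
    then show "(\<lambda>x. pd k f x - (\<Sum>l\<in>UNIV. K k l * x $ l)) differentiable at x"
      by (rule differentiableI)
    show "pd j (\<lambda>x. pd k f x - (\<Sum>l\<in>UNIV. K k l * x $ l)) x = 0"
      using pdI[OF D] by (simp add: K[OF x] sym[of k] mult.commute)
  qed
  then obtain b where b: "\<And>x k. x \<in> S \<Longrightarrow> pd k f x = b k + (\<Sum>l\<in>UNIV. K k l * x $ l)"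
    by (metis diff_add_cancel)
  \<comment> \<open>The leading \<open>0 +\<close> keeps the shape of
    \<open>quadratic_has_derivative\<close> at \<open>c = 0\<close>.\<close>
  have "\<exists>c. \<forall>x\<in>S. f x - (0 + (\<Sum>j\<in>UNIV. b j * x $ j)
      + (\<Sum>j\<in>UNIV. \<Sum>k\<in>UNIV. K j k * x $ j * x $ k) / 2) = c" (is "\<exists>c. \<forall>x\<in>S. f x - ?q x = c")
  proof (rule zero_pd_imp_constant[OF assms(1,2)])
    fix x j assume x: "x \<in> S"
    note D = has_derivative_diff[OF
        pd_has_derivative[OF smooth_on_imp_differentiable[OF smooth x]] quadratic_has_derivative[where K = K and b = b and c = 0, OF sym]]
    show "(\<lambda>x. f x - ?q x) differentiable at x"
      by (rule differentiableI[OF D])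
    show "pd j (\<lambda>x. f x - ?q x) x = 0"
      using pdI[OF D] by (simp add: b[OF x])
  qed
  then obtain c where "\<And>x. x \<in> S \<Longrightarrow> f x - ?q x = c" by blast
  then have "f x = c + (\<Sum>j\<in>UNIV. b j * x $ j)
      + (\<Sum>j\<in>UNIV. \<Sum>k\<in>UNIV. K j k * x $ j * x $ k) / 2" if "x \<in> S" for x
    using that by (simp add: algebra_simps)
  then show ?thesis by (rule that)
qed

section \<open>The equilibrium equations\<close>

lemma smooth_on_strain:
  assumes "open \<Omega>" "smooth_on \<Omega> u"
  shows "smooth_on \<Omega> (strain u l m)"
  unfolding strain_def[abs_def]
  by (intro smooth_on_divide smooth_on_add smooth_on_pd smooth_on_component assms)

lemma pd_strain:
  assumes "open \<Omega>" "smooth_on \<Omega> u" "x \<in> \<Omega>"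
  shows "pd n (strain u l m) x =
    (pd n (pd m (\<lambda>y. u y $ l)) x + pd n (pd l (\<lambda>y. u y $ m)) x) / 2"
proof -
  have s: "smooth_on \<Omega> (pd j (\<lambda>y. u y $ i))" for i j
    by (intro smooth_on_pd smooth_on_component assms)
  show ?thesis
    unfolding strain_def[abs_def]
    by (simp add: pd_divide_right pd_add smooth_on_imp_differentiable[OF _ assms(3)] s smooth_on_add assms(1))
qed

lemma pd_pd_strain:
  assumes "open \<Omega>" "smooth_on \<Omega> u" "x \<in> \<Omega>"
  shows "pd i (pd n (strain u l m)) x =
    (pd i (pd n (pd m (\<lambda>y. u y $ l))) x + pd i (pd n (pd l (\<lambda>y. u y $ m))) x) / 2"
proof -
  have s: "smooth_on \<Omega> (pd k (pd j (\<lambda>y. u y $ i)))" for i j k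
    by (intro smooth_on_pd smooth_on_component assms)
  have "pd i (pd n (strain u l m)) x =
      pd i (\<lambda>x. (pd n (pd m (\<lambda>y. u y $ l)) x + pd n (pd l (\<lambda>y. u y $ m)) x) / 2) x"
    by (rule pd_cong[OF assms(1,3)]) (simp add: pd_strain[OF assms(1,2)])
  also have "\<dots> = (pd i (pd n (pd m (\<lambda>y. u y $ l))) x + pd i (pd n (pd l (\<lambda>y. u y $ m))) x) / 2"
    by (simp add: pd_divide_right pd_add smooth_on_imp_differentiable[OF _ assms(3)] s smooth_on_add assms(1))
  finally show ?thesis .
qed

text \<open>The material tensors are constant and leave the derivatives. Each material thus yields
  an explicit linear equation in derivatives of the strain.\<close>

lemma equilibrium_iff:
  assumes "open \<Omega>" "smooth_on \<Omega> u"
  shows "equilibrium (C, M, A) \<Omega> u \<longleftrightarrow> (\<forall>x\<in>\<Omega>. \<forall>i.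
    (\<Sum>j\<in>UNIV. (\<Sum>l\<in>UNIV. \<Sum>m\<in>UNIV. C i j l m * pd j (strain u l m) x) +
      (\<Sum>l\<in>UNIV. \<Sum>m\<in>UNIV. \<Sum>n\<in>UNIV. M i j l m n * pd j (pd n (strain u l m)) x)) -
    (\<Sum>j\<in>UNIV. \<Sum>k\<in>UNIV. (\<Sum>l\<in>UNIV. \<Sum>m\<in>UNIV. M l m i j k * pd k (pd j (strain u l m)) x) +
      (\<Sum>l\<in>UNIV. \<Sum>m\<in>UNIV. \<Sum>n\<in>UNIV. A i j k l m n * pd k (pd j (pd n (strain u l m))) x)) = 0)"
proof -
  note smooth = smooth_on_strain[OF assms] smooth_on_pd smooth_on_mult_left[OF assms(1)]
    smooth_on_sum[OF assms(1)] smooth_on_add[OF assms(1)]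
  have stress: "pd j (stress (C, M, A) u i j) x =
      (\<Sum>l\<in>UNIV. \<Sum>m\<in>UNIV. C i j l m * pd j (strain u l m) x) +
      (\<Sum>l\<in>UNIV. \<Sum>m\<in>UNIV. \<Sum>n\<in>UNIV. M i j l m n * pd j (pd n (strain u l m)) x)"
    if "x \<in> \<Omega>" for x i j
    unfolding stress_def prod.case
    by (simp add: pd_add pd_sum pd_mult_left smooth smooth_on_imp_differentiable[OF _ that])
  have hyp: "pd j (hyperstress (C, M, A) u i j k) x =
      (\<Sum>l\<in>UNIV. \<Sum>m\<in>UNIV. M l m i j k * pd j (strain u l m) x) +
      (\<Sum>l\<in>UNIV. \<Sum>m\<in>UNIV. \<Sum>n\<in>UNIV. A i j k l m n * pd j (pd n (strain u l m)) x)"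
    if "x \<in> \<Omega>" for x i j k
    unfolding hyperstress_def prod.case
    by (simp add: pd_add pd_sum pd_mult_left smooth smooth_on_imp_differentiable[OF _ that])
  have "pd k (pd j (hyperstress (C, M, A) u i j k)) x =
      (\<Sum>l\<in>UNIV. \<Sum>m\<in>UNIV. M l m i j k * pd k (pd j (strain u l m)) x) +
      (\<Sum>l\<in>UNIV. \<Sum>m\<in>UNIV. \<Sum>n\<in>UNIV. A i j k l m n * pd k (pd j (pd n (strain u l m))) x)"
    if "x \<in> \<Omega>" for x i j k
    \<comment> \<open>\<open>hyp\<close> is an identity on \<Omega> only, so it enters under the
      outer derivative through \<open>pd_cong\<close>; linearity is used afterwards.\<close>
    by (simp add: pd_cong[OF assms(1) that hyp], simp add: pd_add pd_sum pd_mult_left smooth smooth_on_imp_differentiable[OF _ that])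
  with stress show ?thesis unfolding equilibrium_def by simp
qed

section \<open>The tetragonal groups\<close>

text \<open>With this encoding the contraction with a row collapses to one term, so the nested sums
  in the invariance conditions become single products.\<close>

definition signed_perm :: "(3 \<Rightarrow> 3) \<Rightarrow> (3 \<Rightarrow> real) \<Rightarrow> real^3^3" where
  "signed_perm p s = (\<chi> i j. if j = p i then s i else 0)"

definition swap12 :: "3 \<Rightarrow> 3" where
  "swap12 = id(1 := 2, 2 := 1)"

text \<open>The 16 matrices described this way are the symmetries of a square prism. Only the
  inclusion of the groups in this set is proved below, which suffices to verify invariance of test
  tensors.\<close>

definition tetragonal :: "(3 \<Rightarrow> 3) \<Rightarrow> (3 \<Rightarrow> real) \<Rightarrow> bool" where
  "tetragonal p s \<longleftrightarrow> (p = id \<or> p = swap12) \<and> (\<forall>i. s i * s i = 1)"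

lemma swap12_simps [simp]: "swap12 1 = 2" "swap12 2 = 1" "swap12 3 = 3"
  by (simp_all add: swap12_def)

lemma swap12_swap12 [simp]: "swap12 (swap12 i) = i"
  by (simp add: swap12_def)

lemma swap12_eq_iff [simp]: "swap12 i = swap12 j \<longleftrightarrow> i = j" "swap12 i = 3 \<longleftrightarrow> i = 3"
  by (metis swap12_swap12, metis swap12_swap12 swap12_simps(3))

lemma sum_signed_perm: "(\<Sum>j\<in>UNIV. signed_perm p s $ i $ j * F j) = s i * F (p i)"
  by (simp add: signed_perm_def if_distrib[of "\<lambda>z. z * _"] cong: if_cong)

lemma signed_perm_mult:
  "signed_perm p s ** signed_perm q t = signed_perm (q \<circ> p) (\<lambda>i. s i * t (p i))"
  by (simp add: vec_eq_iff matrix_matrix_mult_def sum_signed_perm) (auto simp: signed_perm_def)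

lemma signed_perm_uminus: "- signed_perm p s = signed_perm p (\<lambda>i. - s i)"
  by (simp add: vec_eq_iff signed_perm_def)

lemma signed_perm_id: "mat 1 = signed_perm id (\<lambda>i. 1)"
  by (auto simp: vec_eq_iff signed_perm_def mat_def)

lemma R4_signed_perm: "R4 = signed_perm swap12 (\<lambda>i. if i = 1 then - 1 else 1)"
  by (simp add: R4_def signed_perm_def vec_eq_iff forall_3)

lemma R2_signed_perm: "R2 = signed_perm id (\<lambda>i. if i = 1 then 1 else - 1)"
  by (simp add: R2_def signed_perm_def vec_eq_iff forall_3)

lemma tetragonal_mult:
  "tetragonal p s \<Longrightarrow> tetragonal q t \<Longrightarrow> tetragonal (q \<circ> p) (\<lambda>i. s i * t (p i))"
  by (auto simp: tetragonal_def fun_eq_iff mult_ac)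

lemma tetragonal_transpose:
  "tetragonal p s \<Longrightarrow> transpose (signed_perm p s) = signed_perm p (\<lambda>i. s (p i))"
  by (auto simp: tetragonal_def transpose_def signed_perm_def vec_eq_iff)

lemma inv_O3: "Q \<in> carrier O3 \<Longrightarrow> inv\<^bsub>O3\<^esub> Q = transpose Q"
  by (rule group.inv_equality[OF group_O3]) (auto simp: O3_def orthogonal_matrix_def)

text \<open>Induction over the generated group. The property \<open>P\<close> is left abstract so
  that one argument serves both the plain tetragonal condition and the finer one for
  \<open>Z4_minus\<close>. The closure condition with \<open>s (p i)\<close> is closure under
  inverses: the inverse is the transpose, and \<open>p\<close> is an involution.\<close>

lemma generate_signed_perm:
  assumes P: "\<And>p s. P p s \<Longrightarrow> tetragonal p s"
    and "P id (\<lambda>i. 1)" "\<And>p s. P p s \<Longrightarrow> P p (\<lambda>i. s (p i))"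
    and "\<And>p s q t. P p s \<Longrightarrow> P q t \<Longrightarrow> P (q \<circ> p) (\<lambda>i. s i * t (p i))"
    and S: "\<And>Q. Q \<in> S \<Longrightarrow> Q \<in> carrier O3 \<and> (\<exists>p s. Q = signed_perm p s \<and> P p s)"
    and "Q \<in> generate O3 S"
  shows "\<exists>p s. Q = signed_perm p s \<and> P p s"
  using assms(6)
proof (induction rule: generate.induct)
  case one
  then show ?case using assms(2) signed_perm_id unfolding O3_def by auto
next
  case (incl h)
  then show ?case using S by blast
next
  case (inv h)
  then obtain p s where h: "h = signed_perm p s" "P p s" "h \<in> carrier O3"
    using S by blast
  then have "inv\<^bsub>O3\<^esub> h = signed_perm p (\<lambda>i. s (p i))"
    by (simp add: inv_O3 tetragonal_transpose P)
  then show ?case using h(2) assms(3) by blast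
next
  case (eng h1 h2)
  then obtain p s q t where "h1 = signed_perm p s" "P p s" "h2 = signed_perm q t" "P q t" by blast
  then show ?case
    using assms(4)[of p s q t] signed_perm_mult[of p s q t] unfolding O3_def by auto
qed

lemma uminus_id_O3: "- mat 1 \<in> carrier O3"
  by (rule uminus_O3) (simp add: O3_def orthogonal_matrix_id)

lemma plus_Z2c_D4_signed_perm:
  assumes "Q \<in> plus_Z2c D4"
  shows "\<exists>p s. Q = signed_perm p s \<and> tetragonal p s"
proof -
  \<comment> \<open>Stated for any generating set because it is used twice: for \<open>D4\<close>,
    and for the group generated by \<open>D4\<close> together with -I.\<close>
  have *: "\<exists>p s. Q = signed_perm p s \<and> tetragonal p s"
    if "\<And>Q. Q \<in> S \<Longrightarrow> Q \<in> carrier O3 \<and> (\<exists>p s. Q = signed_perm p s \<and> tetragonal p s)"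
      "Q \<in> generate O3 S" for S Q
    by (rule generate_signed_perm[OF _ _ _ _ that])
      (assumption | rule tetragonal_mult | simp add: tetragonal_def)+
  have "R4 = signed_perm swap12 (\<lambda>i. if i = 1 then - 1 else 1) \<and> tetragonal swap12 (\<lambda>i. if i = 1 then - 1 else 1)"
    "R2 = signed_perm id (\<lambda>i. if i = 1 then 1 else - 1) \<and> tetragonal id (\<lambda>i. if i = 1 then 1 else - 1)"
    "- mat 1 = signed_perm id (\<lambda>i. - 1) \<and> tetragonal id (\<lambda>i. - 1)"
    by (simp_all add: tetragonal_def R4_signed_perm R2_signed_perm signed_perm_id signed_perm_uminus)
  then have gens: "\<exists>p s. R4 = signed_perm p s \<and> tetragonal p s" "\<exists>p s. R2 = signed_perm p s \<and> tetragonal p s"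
    "\<exists>p s. - mat 1 = signed_perm p s \<and> tetragonal p s"
    by blast+
  have "\<exists>p s. Q = signed_perm p s \<and> tetragonal p s" if "Q \<in> D4" for Q
    by (rule *[OF _ that[unfolded D4_def]]) (use gens R4_O3 R2_O3 in auto)
  then show ?thesis
    by (intro *[OF _ assms[unfolded plus_Z2c_def]])
      (use gens uminus_id_O3 subgroup.subset[OF subgroup_D4] in auto)
qed

text \<open>The generator -R exchanges the first two axes and reverses the third. The relation
  "exchange exactly when reversal" is multiplicative because both permutations fix 3, and it is the
  information about \<open>Z4_minus\<close> that \<open>coupling_invariant\<close> relies
  on.\<close>

lemma Z4_minus_signed_perm:
  assumes "Q \<in> Z4_minus"
  shows "\<exists>p s. Q = signed_perm p s \<and> tetragonal p s \<and> s 3 = (if p = id then 1 else - 1)"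
proof (rule generate_signed_perm[OF _ _ _ _ _ assms[unfolded Z4_minus_def]])
  have neq: "swap12 \<noteq> id" by (auto simp: fun_eq_iff intro!: exI[of _ 1])
  have "tetragonal swap12 (\<lambda>i. - (if i = 1 then - 1 else 1))" by (simp add: tetragonal_def)
  then show "Q \<in> carrier O3 \<and> (\<exists>p s. Q = signed_perm p s \<and> tetragonal p s \<and> s 3 = (if p = id then 1 else - 1))"
    if "Q \<in> {- R4}" for Q
  proof -
    have "Q = signed_perm swap12 (\<lambda>i. - (if i = 1 then - 1 else 1))"
      using that by (simp add: R4_signed_perm signed_perm_uminus)
    moreover have "Q \<in> carrier O3" using that R4_O3 uminus_O3 by blast
    ultimately show ?thesis
      using neq \<open>tetragonal swap12 _\<close>
      by (intro conjI exI[of _ swap12] exI[of _ "\<lambda>i. - (if i = 1 then - 1 else 1)"]) simp_all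
  qed
  have swap: "swap12 \<circ> swap12 = id" by (simp add: fun_eq_iff)
  show "tetragonal (q \<circ> p) (\<lambda>i. s i * t (p i)) \<and> s 3 * t (p 3) = (if q \<circ> p = id then 1 else - 1)"
    if "tetragonal p s \<and> s 3 = (if p = id then 1 else - 1)"
      "tetragonal q t \<and> t 3 = (if q = id then 1 else - 1)" for p s q t
  proof
    show "tetragonal (q \<circ> p) (\<lambda>i. s i * t (p i))" using that by (simp add: tetragonal_mult)
    have "p = id \<or> p = swap12" "q = id \<or> q = swap12" using that by (auto simp: tetragonal_def)
    then show "s 3 * t (p 3) = (if q \<circ> p = id then 1 else - 1)"
      using that neq swap by auto
  qed
qed (auto simp: tetragonal_def)

section \<open>Test materials\<close>

text \<open>The tetragonal stiffness tensor in its six Voigt constants. Its entries depend only on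
  which indices coincide and which equal 3, a pattern that \<open>swap12\<close> preserves.\<close>

definition elastic_material :: "real \<Rightarrow> real \<Rightarrow> real \<Rightarrow> real \<Rightarrow> real \<Rightarrow> real \<Rightarrow> tensor4" where
  "elastic_material c11 c12 c13 c33 c66 c44 i j l m =
    (if i = j \<and> l = m then
       if i = 3 \<and> l = 3 then c33 else if i = 3 \<or> l = 3 then c13 else if i = l then c11 else c12
     else if (i = l \<and> j = m) \<or> (i = m \<and> j = l) then if i = 3 \<or> j = 3 then c44 else c66
     else 0)"

text \<open>
  The nonzero components are \<open>M\<^sub>1\<^sub>1\<^sub>3\<^sub>1\<^sub>1 = 1\<close> and \<open>M\<^sub>2\<^sub>2\<^sub>3\<^sub>2\<^sub>2 = - 1\<close> and their symmetric images. For a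
  displacement \<open>(0, 0, h(x\<^sub>1, x\<^sub>2))\<close> the first two equilibrium equations become \<open>h\<^sub>,\<^sub>1\<^sub>1\<^sub>1 = 0\<close> and
  \<open>h\<^sub>,\<^sub>2\<^sub>2\<^sub>2 = 0\<close>.
\<close>

definition coupling_sign :: "3 \<Rightarrow> real" where
  "coupling_sign i = (if i = 1 then 1 else if i = 2 then - 1 else 0)"

definition coupling_material :: tensor5 where
  "coupling_material i j k l m =
    (if i = j \<and> j = m \<and> ((k = i \<and> l = 3) \<or> (k = 3 \<and> l = i)) then coupling_sign i else 0)"

text \<open>In a nonzero component the indices match in pairs, so every sign occurs squared.\<close>

lemma elastic_invariant: "invariant4 (plus_Z2c D4) (elastic_material c11 c12 c13 c33 c66 c44)"
  (is "invariant4 _ ?C")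
proof -
  have "s i * s j * s l * s m * ?C (p i) (p j) (p l) (p m) = ?C i j l m" if "tetragonal p s" for p s i j l m
  proof -
    have s: "s i * s i = 1" for i using that by (simp add: tetragonal_def)
    have s': "s i * (s i * z) = z" for i z using s[of i] by (simp flip: mult.assoc)
    have p: "p a = p b \<longleftrightarrow> a = b" "p a = 3 \<longleftrightarrow> a = 3" for a b
      using that by (auto simp: tetragonal_def)
    have C: "?C (p i) (p j) (p l) (p m) = ?C i j l m" unfolding elastic_material_def p ..
    have "i = j \<and> l = m \<or> i = l \<and> j = m \<or> i = m \<and> j = l \<or> ?C i j l m = 0"
      by (simp add: elastic_material_def)
    then consider "i = j" "l = m" | "i = l" "j = m" | "i = m" "j = l" | "?C i j l m = 0"
      by blast
    then show ?thesis unfolding C by cases (simp_all add: s s' mult_ac)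
  qed
  note inv = this
  show ?thesis
    unfolding invariant4_def
  proof (intro ballI allI)
    fix Q i j l m assume "Q \<in> plus_Z2c D4"
    then obtain p s where Q: "Q = signed_perm p s" and ps: "tetragonal p s" using plus_Z2c_D4_signed_perm by blast
    show "(\<Sum>i'\<in>UNIV. \<Sum>j'\<in>UNIV. \<Sum>l'\<in>UNIV. \<Sum>m'\<in>UNIV.
        Q$i$i' * Q$j$j' * Q$l$l' * Q$m$m' * ?C i' j' l' m') = ?C i j l m"
      using inv[OF ps, of i j l m]
      by (simp only: Q mult.assoc sum_distrib_left[symmetric] sum_signed_perm)
  qed
qed

text \<open>In a nonzero component four indices are equal and one is 3, so the signs multiply to
  \<open>s 3\<close>. The permutation contributes a second factor \<open>s 3\<close>, because
  \<open>coupling_sign\<close> changes sign under the exchange of 1 and 2. Setting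
  \<open>coupling_sign 3 = 0\<close> removes the component with all indices 3, which would violate
  this rule.\<close>

lemma coupling_invariant: "invariant5 Z4_minus coupling_material"
proof -
  have "s i * s j * s k * s l * s m * coupling_material (p i) (p j) (p k) (p l) (p m)
      = coupling_material i j k l m"
    if "tetragonal p s" "s 3 = (if p = id then 1 else - 1)" for p s i j k l m
  proof -
    have s: "s i * s i = 1" for i using that by (simp add: tetragonal_def)
    have s': "s i * (s i * z) = z" for i z using s[of i] by (simp flip: mult.assoc)
    have p: "p a = p b \<longleftrightarrow> a = b" "p a = 3 \<longleftrightarrow> a = 3" for a b
      using that(1) by (auto simp: tetragonal_def)
    have c: "coupling_sign (p i) = s 3 * coupling_sign i" for i
      using that exhaust_3[of i] by (auto simp: tetragonal_def coupling_sign_def)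
    have M: "coupling_material (p i) (p j) (p k) (p l) (p m) = s 3 * coupling_material i j k l m"
      using c by (auto simp: coupling_material_def p)
    have "i = j \<and> j = m \<and> (k = i \<and> l = 3 \<or> k = 3 \<and> l = i) \<or> coupling_material i j k l m = 0"
      by (auto simp: coupling_material_def)
    then consider "i = j" "j = m" "k = i" "l = 3" | "i = j" "j = m" "k = 3" "l = i"
      | "coupling_material i j k l m = 0"
      by blast
    then show ?thesis unfolding M by cases (simp_all add: s s' mult_ac)
  qed
  note inv = this
  show ?thesis
    unfolding invariant5_def
  proof (intro ballI allI)
    fix Q i j k l m assume "Q \<in> Z4_minus"
    then obtain p s where Q: "Q = signed_perm p s" and ps: "tetragonal p s" "s 3 = (if p = id then 1 else - 1)"
      using Z4_minus_signed_perm by blast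
    show "(\<Sum>i'\<in>UNIV. \<Sum>j'\<in>UNIV. \<Sum>k'\<in>UNIV. \<Sum>l'\<in>UNIV. \<Sum>m'\<in>UNIV.
        Q$i$i' * Q$j$j' * Q$k$k' * Q$l$l' * Q$m$m' * coupling_material i' j' k' l' m')
        = coupling_material i j k l m"
      using inv[OF ps, of i j k l m]
      by (simp only: Q mult.assoc sum_distrib_left[symmetric] sum_signed_perm)
  qed
qed

lemma elastic_in_class:
  "(elastic_material c11 c12 c13 c33 c66 c44, \<lambda>_ _ _ _ _. 0, \<lambda>_ _ _ _ _ _. 0) \<in> class_Z4_minus"
proof -
  let ?C = "elastic_material c11 c12 c13 c33 c66 c44"
  have "?C i j l m = ?C j i l m" "?C i j l m = ?C l m i j" for i j l m
    by (cases "i = j"; cases "l = m"; cases "i = l"; cases "j = m"; cases "i = m";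
        simp add: elastic_material_def)+
  then have "(?C, \<lambda>_ _ _ _ _. 0, \<lambda>_ _ _ _ _ _. 0) \<in> strain_gradient_materials"
    unfolding strain_gradient_materials_def by blast
  then show ?thesis
    using elastic_invariant by (simp add: class_Z4_minus_def invariant5_def invariant6_def)
qed

lemma coupling_in_class: "(\<lambda>_ _ _ _. 0, coupling_material, \<lambda>_ _ _ _ _ _. 0) \<in> class_Z4_minus"
proof -
  have "coupling_material i j k l m = coupling_material j i k l m"
    "coupling_material i j k l m = coupling_material i j l k m" for i j k l m
    by (auto simp: coupling_material_def)
  then have "(\<lambda>_ _ _ _. 0, coupling_material, \<lambda>_ _ _ _ _ _. 0) \<in> strain_gradient_materials"
    unfolding strain_gradient_materials_def by blast
  then show ?thesis
    using coupling_invariant by (simp add: class_Z4_minus_def invariant4_def invariant6_def)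
qed

section \<open>Universal displacements\<close>

text \<open>The second derivatives \<open>u\<^sub>l\<^sub>,\<^sub>j\<^sub>k\<close> of the inhomogeneous part, as \<open>hess \<dots> l j k\<close>.\<close>

definition hess :: "real \<Rightarrow> real \<Rightarrow> real \<Rightarrow> real \<Rightarrow> real \<Rightarrow> 3 \<Rightarrow> 3 \<Rightarrow> 3 \<Rightarrow> real" where
  "hess c1 c2 c3 d4 d5 l j k =
    (if l = 1 then if {j, k} = {2, 3} then c1 else if {j, k} = {1, 3} then c2 else 0
     else if l = 2 then if {j, k} = {2, 3} then - c2 else if {j, k} = {1, 3} then c3 else 0
     else if {j, k} = {1, 2} then d4
     else if j = 1 \<and> k = 1 then - 2 * d5 else if j = 2 \<and> k = 2 then 2 * d5 else 0)"

lemma hess_sym: "hess c1 c2 c3 d4 d5 l j k = hess c1 c2 c3 d4 d5 l k j"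
proof -
  have "\<forall>l j k. hess c1 c2 c3 d4 d5 l j k = hess c1 c2 c3 d4 d5 l k j"
    unfolding forall_3 by (simp add: hess_def doubleton_eq_iff)
  then show ?thesis by blast
qed

section \<open>Sufficiency: tetragonal elasticity on the quadratic fields\<close>

lemma invariant4_signed_perm:
  assumes "invariant4 G T" "signed_perm p s \<in> G"
  shows "s i * (s j * (s l * (s m * T (p i) (p j) (p l) (p m)))) = T i j l m"
proof -
  have "(\<Sum>i'\<in>UNIV. \<Sum>j'\<in>UNIV. \<Sum>l'\<in>UNIV. \<Sum>m'\<in>UNIV. signed_perm p s $ i $ i' * signed_perm p s $ j $ j' *
      signed_perm p s $ l $ l' * signed_perm p s $ m $ m' * T i' j' l' m') = T i j l m"
    using assms unfolding invariant4_def by blast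
  then show ?thesis by (simp only: mult.assoc sum_distrib_left[symmetric] sum_signed_perm)
qed

lemma invariant4_sign_zero:
  assumes "invariant4 G T" "signed_perm id s \<in> G" "s i * (s j * (s l * s m)) = - 1"
  shows "T i j l m = 0"
proof -
  have "(s i * (s j * (s l * s m))) * T i j l m = T i j l m"
    using invariant4_signed_perm[OF assms(1,2)] by (simp only: id_apply mult.assoc)
  then show ?thesis unfolding assms(3) by simp
qed

lemma hess_imp_universal:
  assumes \<Omega>: "open \<Omega>" and smooth: "smooth_on \<Omega> u"
    and H: "\<And>x l j k. x \<in> \<Omega> \<Longrightarrow> pd j (pd k (\<lambda>y. u y $ l)) x = hess c1 c2 c3 d4 d5 l j k"
  shows "universal class_Z4_minus \<Omega> u"
  unfolding universal_def
proof
  fix \<mu> assume "\<mu> \<in> class_Z4_minus"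
  then obtain C M A where \<mu>: "\<mu> = (C, M, A)" and C: "invariant4 (plus_Z2c D4) C"
    unfolding class_Z4_minus_def by auto
  define g where "g l m j = (hess c1 c2 c3 d4 d5 l j m + hess c1 c2 c3 d4 d5 m j l) / 2" for l m j
  have g: "pd j (strain u l m) x = g l m j" if "x \<in> \<Omega>" for x j l m
    using pd_strain[OF \<Omega> smooth that] H[OF that] by (simp add: g_def)
  have g2: "pd k (pd j (strain u l m)) x = 0" if "x \<in> \<Omega>" for x j k l m
    using pd_cong[OF \<Omega> that g] by simp
  have g3: "pd n (pd k (pd j (strain u l m))) x = 0" if "x \<in> \<Omega>" for x j k l m n
    using pd_cong[OF \<Omega> that g2] by simp
  have R: "R4 \<in> plus_Z2c D4" "R2 \<in> plus_Z2c D4"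
    unfolding plus_Z2c_def D4_def by (auto intro!: generate.incl)
  then have "R4 ** R4 \<in> plus_Z2c D4"
    using generate.eng[of R4 O3 "D4 \<union> {- mat 1}" R4] unfolding plus_Z2c_def O3_def by simp
  note R = R this
  have "R4 ** R4 = signed_perm id (\<lambda>i. if i = 3 then 1 else - 1)"
    unfolding R4_signed_perm signed_perm_mult
    by (rule arg_cong2[of _ _ _ _ signed_perm]) (simp_all add: fun_eq_iff forall_3)
  \<comment> \<open>\<open>R2\<close> kills the components in which index 1 occurs an odd number of
    times, \<open>R4 ** R4\<close> those with an odd number of 3s. As the order is even, only
    components with every index occurring evenly survive.\<close>
  note zero = invariant4_sign_zero[OF C R(2)[unfolded R2_signed_perm]]
    invariant4_sign_zero[OF C R(3)[unfolded this]]
  \<comment> \<open>These equalities are what the third equation needs: its sum then factors through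
    u1,13 + u2,23 = c2 - c2 and u3,11 + u3,22 = -2 d5 + 2 d5. In the first two equations every
    surviving term already has a vanishing strain derivative.\<close>
  have swap: "C 3 3 2 2 = C 3 3 1 1" "C 3 2 3 2 = C 3 1 3 1" "C 3 2 2 3 = C 3 1 1 3"
    using invariant4_signed_perm[OF C R(1)[unfolded R4_signed_perm], of 3 3 1 1]
      invariant4_signed_perm[OF C R(1)[unfolded R4_signed_perm], of 3 1 3 1]
      invariant4_signed_perm[OF C R(1)[unfolded R4_signed_perm], of 3 1 1 3] by simp_all
  have "(\<Sum>j\<in>UNIV. \<Sum>l\<in>UNIV. \<Sum>m\<in>UNIV. C 3 j l m * g l m j) = 0"
    by (simp add: sum_3 zero swap g_def hess_def doubleton_eq_iff) (simp add: field_simps)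
  moreover have "(\<Sum>j\<in>UNIV. \<Sum>l\<in>UNIV. \<Sum>m\<in>UNIV. C 1 j l m * g l m j) = 0"
    "(\<Sum>j\<in>UNIV. \<Sum>l\<in>UNIV. \<Sum>m\<in>UNIV. C 2 j l m * g l m j) = 0"
    by (simp_all add: sum_3 zero g_def hess_def doubleton_eq_iff)
  ultimately have "\<forall>i. (\<Sum>j\<in>UNIV. \<Sum>l\<in>UNIV. \<Sum>m\<in>UNIV. C i j l m * g l m j) = 0"
    unfolding forall_3 by blast
  then show "equilibrium \<mu> \<Omega> u"
    unfolding \<mu> equilibrium_iff[OF \<Omega> smooth] by (simp add: g g2 g3)
qed

text \<open>Necessity, phrased through second derivatives: the test materials annihilate all third
  derivatives, so the second derivatives are constants, and these satisfy the linear relations built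
  into \<open>hess\<close>.\<close>

lemma universal_imp_hess:
  assumes \<Omega>: "open \<Omega>" "convex \<Omega>" "\<Omega> \<noteq> {}" and smooth: "smooth_on \<Omega> u"
    and univ: "universal class_Z4_minus \<Omega> u"
  obtains c1 c2 c3 d4 d5 where
    "\<And>x l j k. x \<in> \<Omega> \<Longrightarrow> pd j (pd k (\<lambda>y. u y $ l)) x = hess c1 c2 c3 d4 d5 l j k"
proof -
  define D where "D l j k = pd j (pd k (\<lambda>y. u y $ l))" for l j k
  have smooth_D: "smooth_on \<Omega> (D l j k)" for l j k
    unfolding D_def by (intro smooth_on_pd smooth_on_component \<Omega> smooth)
  have strain: "pd j (strain u l m) x = (D l j m x + D m j l x) / 2" if "x \<in> \<Omega>" for x j l m
    unfolding D_def by (rule pd_strain[OF \<Omega>(1) smooth that])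
  have strain2: "pd k (pd j (strain u l m)) x = (pd k (D l j m) x + pd k (D m j l) x) / 2"
    if "x \<in> \<Omega>" for x j k l m
    unfolding D_def by (rule pd_pd_strain[OF \<Omega>(1) smooth that])
  have sym: "D l j k x = D l k j x" if "x \<in> \<Omega>" for l j k x
    unfolding D_def by (rule pd_commute[OF \<Omega>(1) smooth_on_component[OF \<Omega>(1) smooth] that])
  have pd_sym: "pd i (D l j k) x = pd i (D l k j) x" if "x \<in> \<Omega>" for i l j k x
    by (rule pd_cong[OF \<Omega>(1) that sym])
  have pd_swap: "pd i (D l j k) x = pd j (D l i k) x" if "x \<in> \<Omega>" for i l j k x
    unfolding D_def
    by (rule pd_commute[OF \<Omega>(1) smooth_on_pd[OF smooth_on_component[OF \<Omega>(1) smooth]] that])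
  have elastic: "(\<Sum>j\<in>UNIV. \<Sum>l\<in>UNIV. \<Sum>m\<in>UNIV.
      elastic_material c11 c12 c13 c33 c66 c44 i j l m * ((D l j m x + D m j l x) / 2)) = 0"
    if "x \<in> \<Omega>" for c11 c12 c13 c33 c66 c44 i x
  proof -
    have "equilibrium (elastic_material c11 c12 c13 c33 c66 c44, \<lambda>_ _ _ _ _. 0, \<lambda>_ _ _ _ _ _. 0) \<Omega> u"
      using univ elastic_in_class unfolding universal_def by blast
    then show ?thesis
      unfolding equilibrium_iff[OF \<Omega>(1) smooth] using that by (simp add: strain)
  qed
  \<comment> \<open>From here to \<open>c44\<close>, the last argument of \<open>elastic\<close> is
    the equation index and exactly one of the six constants is 1.\<close>
  have c11: "D 1 1 1 x = 0" "D 2 2 2 x = 0" if "x \<in> \<Omega>" for x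
    using elastic[OF that, of 1 0 0 0 0 0 1] elastic[OF that, of 1 0 0 0 0 0 2]
    by (simp_all add: sum_3 elastic_material_def)
  have c12: "D 2 1 2 x = 0" "D 1 2 1 x = 0" if "x \<in> \<Omega>" for x
    using elastic[OF that, of 0 1 0 0 0 0 1] elastic[OF that, of 0 1 0 0 0 0 2]
    by (simp_all add: sum_3 elastic_material_def)
  have c13: "D 3 1 3 x = 0" "D 3 2 3 x = 0" "D 1 3 1 x + D 2 3 2 x = 0" if "x \<in> \<Omega>" for x
    using elastic[OF that, of 0 0 1 0 0 0 1] elastic[OF that, of 0 0 1 0 0 0 2]
      elastic[OF that, of 0 0 1 0 0 0 3]
    by (simp_all add: sum_3 elastic_material_def)
  have c33: "D 3 3 3 x = 0" if "x \<in> \<Omega>" for x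
    using elastic[OF that, of 0 0 0 1 0 0 3] by (simp add: sum_3 elastic_material_def)
  \<comment> \<open>The shear equations read u1,22 + u2,12 = 0 and u2,11 + u1,12 = 0; the mixed
    terms are already zero by \<open>c12\<close>. The first two parts of \<open>c44\<close> use
    \<open>c13\<close> in the same way.\<close>
  have c66: "D 1 2 2 x = 0" "D 2 1 1 x = 0" if "x \<in> \<Omega>" for x
    using elastic[OF that, of 0 0 0 0 1 0 1] elastic[OF that, of 0 0 0 0 1 0 2] c12[OF that]
      sym[OF that, of 1 1 2] sym[OF that, of 2 1 2]
    by (simp_all add: sum_3 elastic_material_def)
  have c44: "D 1 3 3 x = 0" "D 2 3 3 x = 0"
    "D 1 3 1 x + D 3 1 1 x + (D 2 3 2 x + D 3 2 2 x) = 0" if "x \<in> \<Omega>" for x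
    using elastic[OF that, of 0 0 0 0 0 1 1] elastic[OF that, of 0 0 0 0 0 1 2]
      elastic[OF that, of 0 0 0 0 0 1 3] c13[OF that]
      sym[OF that, of 3 1 3] sym[OF that, of 3 2 3] sym[OF that, of 1 1 3] sym[OF that, of 2 2 3]
    by (simp_all add: sum_3 elastic_material_def add.commute add_divide_distrib)
  have harmonic: "D 3 1 1 x + D 3 2 2 x = 0" if "x \<in> \<Omega>" for x
    using c13(3)[OF that] c44(3)[OF that] by simp
  have zero: "D 1 1 1 x = 0" "D 1 1 2 x = 0" "D 1 2 1 x = 0" "D 1 2 2 x = 0" "D 1 3 3 x = 0"
    "D 2 1 1 x = 0" "D 2 1 2 x = 0" "D 2 2 1 x = 0" "D 2 2 2 x = 0" "D 2 3 3 x = 0"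
    "D 3 1 3 x = 0" "D 3 3 1 x = 0" "D 3 2 3 x = 0" "D 3 3 2 x = 0" "D 3 3 3 x = 0"
    if "x \<in> \<Omega>" for x
    using c11[OF that] c12[OF that] c13[OF that] c33[OF that] c66[OF that] c44[OF that]
      sym[OF that, of 1 1 2] sym[OF that, of 2 1 2] sym[OF that, of 3 1 3] sym[OF that, of 3 2 3]
    by simp_all
  \<comment> \<open>A second derivative vanishing on all of \<Omega> kills the third derivatives
    with the same indices in other orders.\<close>
  have third: "pd i (D l j k) x = 0 \<and> pd j (D l i k) x = 0 \<and> pd j (D l k i) x = 0"
    if "\<And>x. x \<in> \<Omega> \<Longrightarrow> D l j k x = 0" "x \<in> \<Omega>" for i j k l x
  proof -
    have "pd i (D l j k) x = 0" using pd_cong[OF \<Omega>(1) that(2,1), where j = i] by simp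
    moreover have "pd j (D l i k) x = pd i (D l j k) x" by (rule pd_swap[OF that(2)])
    moreover have "pd j (D l k i) x = pd j (D l i k) x" by (rule pd_sym[OF that(2)])
    ultimately show ?thesis by simp
  qed
  note thirds = zero[THEN third, simplified]
  \<comment> \<open>For u1 and u2 the pairs 11, 12, 22 and 33 vanish, and every triple of indices
    contains one of them.\<close>
  have third12: "\<forall>i j k. pd i (D 1 j k) x = 0" "\<forall>i j k. pd i (D 2 j k) x = 0" if "x \<in> \<Omega>" for x
    unfolding forall_3 by (simp_all add: thirds[OF that])
  have coupling: "(\<Sum>j\<in>UNIV. \<Sum>l\<in>UNIV. \<Sum>m\<in>UNIV. \<Sum>n\<in>UNIV.
        coupling_material i j l m n * ((pd j (D l n m) x + pd j (D m n l) x) / 2)) -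
      (\<Sum>j\<in>UNIV. \<Sum>k\<in>UNIV. \<Sum>l\<in>UNIV. \<Sum>m\<in>UNIV.
        coupling_material l m i j k * ((pd k (D l j m) x + pd k (D m j l) x) / 2)) = 0"
    if "x \<in> \<Omega>" for i x
  proof -
    have "equilibrium (\<lambda>_ _ _ _. 0, coupling_material, \<lambda>_ _ _ _ _ _. 0) \<Omega> u"
      using univ coupling_in_class unfolding universal_def by blast
    then show ?thesis
      unfolding equilibrium_iff[OF \<Omega>(1) smooth] using that by (simp add: strain2)
  qed
  \<comment> \<open>The terms in u1 and u2 vanish by \<open>third12\<close>. The two symmetric
    components of M leave 2 e13,11, which equals u3,111.\<close>
  have h111: "pd 1 (D 3 1 1) x = 0" if "x \<in> \<Omega>" for x
    using coupling[OF that, of 1] third12[OF that]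
    by (simp add: sum_3 coupling_material_def coupling_sign_def)
  have h222: "pd 2 (D 3 2 2) x = 0" if "x \<in> \<Omega>" for x
    using coupling[OF that, of 2] third12[OF that]
    by (simp add: sum_3 coupling_material_def coupling_sign_def)
  have pd_harmonic: "pd i (D 3 1 1) x = - pd i (D 3 2 2) x" if "x \<in> \<Omega>" for i x
  proof -
    have "pd i (D 3 1 1) x = pd i (\<lambda>x. - 1 * D 3 2 2 x) x"
      by (rule pd_cong[OF \<Omega>(1) that]) (use harmonic in \<open>simp add: eq_neg_iff_add_eq_0\<close>)
    also have "\<dots> = - 1 * pd i (D 3 2 2) x"
      by (rule pd_mult_left[OF smooth_on_imp_differentiable[OF smooth_D that]])
    finally show ?thesis by simp
  qed
  have third3: "\<forall>i j k. pd i (D 3 j k) x = 0" if "x \<in> \<Omega>" for x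
  proof -
    \<comment> \<open>Differentiated harmonicity gives u3,112 = -u3,222 and u3,122 = -u3,111;
      triples containing 3 are covered by \<open>thirds\<close>.\<close>
    have "pd 2 (D 3 1 1) x = 0" "pd 1 (D 3 2 2) x = 0"
      using pd_harmonic[OF that, of 2] pd_harmonic[OF that, of 1] h111[OF that] h222[OF that] by simp_all
    moreover have "pd 1 (D 3 2 1) x = pd 2 (D 3 1 1) x" "pd 2 (D 3 1 2) x = pd 1 (D 3 2 2) x"
      "pd 1 (D 3 1 2) x = pd 1 (D 3 2 1) x" "pd 2 (D 3 2 1) x = pd 2 (D 3 1 2) x"
      by (rule pd_swap[OF that] pd_sym[OF that])+
    ultimately show ?thesis
      unfolding forall_3 by (simp add: thirds[OF that] h111[OF that] h222[OF that])
  qed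
  obtain a where a: "a \<in> \<Omega>" using \<Omega>(3) by blast
  have const: "D l j k x = D l j k a" if "x \<in> \<Omega>" for l j k x
  proof -
    have "\<exists>c. \<forall>x\<in>\<Omega>. D l j k x = c"
    proof (rule zero_pd_imp_constant[OF \<Omega>(1,2) smooth_on_imp_differentiable[OF smooth_D]])
      show "pd i (D l j k) x = 0" if "x \<in> \<Omega>" for x i
        using third12[OF that] third3[OF that] exhaust_3[of l] by blast
    qed
    then obtain c where "\<And>x. x \<in> \<Omega> \<Longrightarrow> D l j k x = c" by blast
    then show ?thesis using a that by simp
  qed
  \<comment> \<open>The constants are read off at the base point \<open>a\<close>: u1,23, u1,13,
    u2,13, u3,12 and half of u3,22. The entry -c2 is u2,23 by \<open>c13\<close>, and -2 d5 is u3,11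
    by \<open>harmonic\<close>.\<close>
  have "\<forall>l j k. D l j k a =
      hess (D 1 2 3 a) (D 1 1 3 a) (D 2 1 3 a) (D 3 1 2 a) (D 3 2 2 a / 2) l j k"
    unfolding forall_3
    using zero[OF a] c13(3)[OF a] harmonic[OF a] sym[OF a, of 1 3 1] sym[OF a, of 2 3 1]
      sym[OF a, of 1 3 2] sym[OF a, of 2 3 2] sym[OF a, of 3 2 1]
    by (simp add: hess_def doubleton_eq_iff eq_neg_iff_add_eq_0 add.commute)
  then have "pd j (pd k (\<lambda>y. u y $ l)) x =
      hess (D 1 2 3 a) (D 1 1 3 a) (D 2 1 3 a) (D 3 1 2 a) (D 3 2 2 a / 2) l j k"
    if "x \<in> \<Omega>" for x l j k
    using const[OF that, of l j k] unfolding D_def by metis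
  then show ?thesis by (rule that)
qed

section \<open>Constant second derivatives and quadratic polynomials\<close>

lemma hess_iff_polynomial:
  assumes \<Omega>: "open \<Omega>" "convex \<Omega>" and smooth: "smooth_on \<Omega> u"
  shows "(\<forall>x\<in>\<Omega>. \<forall>l j k. pd j (pd k (\<lambda>y. u y $ l)) x = hess c1 c2 c3 d4 d5 l j k) \<longleftrightarrow>
    (\<exists>a b. \<forall>x\<in>\<Omega>. \<forall>l. u x $ l = a l + (\<Sum>j\<in>UNIV. b l j * x $ j) +
      (\<Sum>j\<in>UNIV. \<Sum>k\<in>UNIV. hess c1 c2 c3 d4 d5 l j k * x $ j * x $ k) / 2)"
    (is "?L \<longleftrightarrow> ?R")
proof
  assume L: ?L
  have "\<exists>a b. \<forall>x\<in>\<Omega>. u x $ l = a + (\<Sum>j\<in>UNIV. b j * x $ j) +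
      (\<Sum>j\<in>UNIV. \<Sum>k\<in>UNIV. hess c1 c2 c3 d4 d5 l j k * x $ j * x $ k) / 2" for l
  proof (rule constant_pd_pd_imp_quadratic[OF \<Omega> smooth_on_component[OF \<Omega>(1) smooth] hess_sym])
    show "pd j (pd k (\<lambda>y. u y $ l)) x = hess c1 c2 c3 d4 d5 l j k" if "x \<in> \<Omega>" for x j k
      using L that by blast
  qed blast
  then have "\<forall>l. \<exists>a b. \<forall>x\<in>\<Omega>. u x $ l = a + (\<Sum>j\<in>UNIV. b j * x $ j) +
      (\<Sum>j\<in>UNIV. \<Sum>k\<in>UNIV. hess c1 c2 c3 d4 d5 l j k * x $ j * x $ k) / 2" ..
  from this[THEN choice, THEN exE] obtain a where
    "\<forall>l. \<exists>b. \<forall>x\<in>\<Omega>. u x $ l = a l + (\<Sum>j\<in>UNIV. b j * x $ j) +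
      (\<Sum>j\<in>UNIV. \<Sum>k\<in>UNIV. hess c1 c2 c3 d4 d5 l j k * x $ j * x $ k) / 2" .
  from this[THEN choice] show ?R by blast
next
  assume ?R
  then obtain a b where u: "\<And>x l. x \<in> \<Omega> \<Longrightarrow> u x $ l = a l + (\<Sum>j\<in>UNIV. b l j * x $ j) +
      (\<Sum>j\<in>UNIV. \<Sum>k\<in>UNIV. hess c1 c2 c3 d4 d5 l j k * x $ j * x $ k) / 2" by blast
  show ?L by (intro ballI allI pd_pd_quadratic[OF \<Omega>(1) _ hess_sym u])
qed

lemma quadratic_form_hess:
  "(\<Sum>j\<in>UNIV. \<Sum>k\<in>UNIV. hess c1 c2 c3 d4 d5 1 j k * x $ j * x $ k) / 2 = c1 * x$2 * x$3 + c2 * x$1 * x$3"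
  "(\<Sum>j\<in>UNIV. \<Sum>k\<in>UNIV. hess c1 c2 c3 d4 d5 2 j k * x $ j * x $ k) / 2 = - c2 * x$2 * x$3 + c3 * x$1 * x$3"
  "(\<Sum>j\<in>UNIV. \<Sum>k\<in>UNIV. hess c1 c2 c3 d4 d5 3 j k * x $ j * x $ k) / 2 =
    d4 * x$1 * x$2 + d5 * ((x$2)\<^sup>2 - (x$1)\<^sup>2)"
  by (simp_all add: sum_3 hess_def doubleton_eq_iff power2_eq_square field_simps)

theorem proposition3p9:
  fixes \<Omega> :: "(real^3) set" and u :: "real^3 \<Rightarrow> real^3"
  assumes "open \<Omega>" and "convex \<Omega>" and "\<Omega> \<noteq> {}"
    and "smooth_on \<Omega> u"
  shows "universal class_Z4_minus \<Omega> u \<longleftrightarrow>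
    (\<exists>v w. homogeneous_on \<Omega> v \<and>
      (\<exists>c1 c2 c3 d1 d2 d3 d4 d5 :: real. \<forall>x\<in>\<Omega>.
        w x = vector
          [c1 * x$2 * x$3 + c2 * x$1 * x$3,
           - c2 * x$2 * x$3 + c3 * x$1 * x$3,
           d1 + d2 * x$1 + d3 * x$2 + d4 * x$1 * x$2 + d5 * ((x$2)\<^sup>2 - (x$1)\<^sup>2)]) \<and>
      (\<forall>x\<in>\<Omega>. u x = v x + w x))"
    (is "_ \<longleftrightarrow> ?form")
proof
  assume "universal class_Z4_minus \<Omega> u"
  then obtain c1 c2 c3 d4 d5 where
    "\<forall>x\<in>\<Omega>. \<forall>l j k. pd j (pd k (\<lambda>y. u y $ l)) x = hess c1 c2 c3 d4 d5 l j k"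
    by (rule universal_imp_hess[OF assms]) blast
  then obtain a b where u: "\<And>x l. x \<in> \<Omega> \<Longrightarrow> u x $ l = a l + (\<Sum>j\<in>UNIV. b l j * x $ j) +
      (\<Sum>j\<in>UNIV. \<Sum>k\<in>UNIV. hess c1 c2 c3 d4 d5 l j k * x $ j * x $ k) / 2"
    unfolding hess_iff_polynomial[OF assms(1,2,4)] by blast
  define v :: "real^3 \<Rightarrow> real^3" where "v x = (\<chi> l j. b l j) *v x + (\<chi> l. a l)" for x
  \<comment> \<open>The affine part of u3 already lies in \<open>v\<close>, so d1, d2, d3 are taken
    to be 0; the zero terms are written out to match the required form.\<close>
  define w :: "real^3 \<Rightarrow> real^3" where "w x = vector
      [c1 * x$2 * x$3 + c2 * x$1 * x$3, - c2 * x$2 * x$3 + c3 * x$1 * x$3,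
       0 + 0 * x$1 + 0 * x$2 + d4 * x$1 * x$2 + d5 * ((x$2)\<^sup>2 - (x$1)\<^sup>2)]" for x
  have "u x = v x + w x" if "x \<in> \<Omega>" for x
    unfolding vec_eq_iff forall_3 u[OF that] quadratic_form_hess
    by (simp add: v_def w_def vector_3 matrix_vector_mult_def)
  moreover have "homogeneous_on \<Omega> v" unfolding homogeneous_on_def v_def by blast
  ultimately show ?form using w_def by blast
next
  assume ?form
  then obtain v w c1 c2 c3 d1 d2 d3 d4 d5 where v: "homogeneous_on \<Omega> v"
    and w: "\<And>x. x \<in> \<Omega> \<Longrightarrow> w x = vector
          [c1 * x$2 * x$3 + c2 * x$1 * x$3, - c2 * x$2 * x$3 + c3 * x$1 * x$3,
           d1 + d2 * x$1 + d3 * x$2 + d4 * x$1 * x$2 + d5 * ((x$2)\<^sup>2 - (x$1)\<^sup>2)]"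
    and u: "\<And>x. x \<in> \<Omega> \<Longrightarrow> u x = v x + w x" by auto
  obtain H :: "real^3^3" and b where H: "\<And>x. x \<in> \<Omega> \<Longrightarrow> v x = H *v x + b"
    using v unfolding homogeneous_on_def by blast
  \<comment> \<open>Conversely, d1, d2, d3 are absorbed into the affine part, leaving exactly the
    quadratic form of \<open>hess\<close>.\<close>
  define b' where "b' l = b $ l + (if l = 3 then d1 else 0)" for l
  define H' where "H' l j = H $ l $ j + (if l = 3 then if j = 1 then d2 else if j = 2 then d3 else 0 else 0)"
    for l j
  have "\<forall>l. u x $ l = b' l + (\<Sum>j\<in>UNIV. H' l j * x $ j) +
      (\<Sum>j\<in>UNIV. \<Sum>k\<in>UNIV. hess c1 c2 c3 d4 d5 l j k * x $ j * x $ k) / 2" if "x \<in> \<Omega>" for x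
    unfolding forall_3 quadratic_form_hess
    by (simp add: u[OF that] w[OF that] H[OF that] vector_3 b'_def H'_def matrix_vector_mult_def
        sum_3 algebra_simps)
  then have "\<forall>x\<in>\<Omega>. \<forall>l j k. pd j (pd k (\<lambda>y. u y $ l)) x = hess c1 c2 c3 d4 d5 l j k"
    unfolding hess_iff_polynomial[OF assms(1,2,4)] by blast
  then show "universal class_Z4_minus \<Omega> u"
    using hess_imp_universal[OF assms(1,4)] by blast
qed

end
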